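(* Let $\Lambda$ be a row-finite $k$-graph without sources, let $1\le i\le k$, let $v\in\Lambda^0$ be an $\mathbf e_i$-sink, and let $\Lambda_S$ be the sink deletion $k$-graph obtained by deleting $v$. Then there is a $\mathbb Z^k$-monoid isomorphism $\phi_S:T_{\Lambda_S}\longrightarrow T_\Lambda$ such that $\phi_S(w(\mathbf n))=w(\mathbf n)$ for all $w\in\Lambda_S^0$ and $\mathbf n\in\mathbb Z^k$.
   Context: $\mathbb N=\{0,1,2,\dots\}$, and $\mathbf e_1,\dots,\mathbf e_k$ is the standard basis of $\mathbb N^k$. A $k$-graph is a countable small category $\Lambda$ with a functor $d:\Lambda\to\mathbb N^k$ (degree) such that whenever $d(\lambda)=\mathbf n+\mathbf m$ there are unique $\alpha,\beta$ with $d(\alpha)=\mathbf n$, $d(\beta)=\mathbf m$, $\lambda=\alpha\beta$. Range and source are $r,s$; $\lambda\mu$ is defined when $s(\lambda)=r(\mu)$. Put $\Lambda^{\mathbf n}=d^{-1}(\mathbf n)$ ($\Lambda^0$ is identified with the objects, called vertices), $u\Lambda^{\mathbf n}=r^{-1}(u)\cap\Lambda^{\mathbf n}$, $\Lambda^{\mathbf n}v=\Lambda^{\mathbf n}\cap s^{-1}(v)$, $w\Lambda v=\{\lambda\in\Lambda: r(\lambda)=w,s(\lambda)=v\}$. $\Lambda$ is row-finite without sources if $0<|v\Lambda^{\mathbf n}|<\infty$ for all $v\in\Lambda^0,\mathbf n\in\mathbb N^k$. Talented monoid: $T_\Lambda$ is the commutative monoid generated by symbols $v(\mathbf n)$, $v\in\Lambda^0,\mathbf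 n\in\mathbb Z^k$, subject to $v(\mathbf n)=\sum_{\alpha\in v\Lambda^{\mathbf e_i}}s(\alpha)(\mathbf n+\mathbf e_i)$ for all $v$, $\mathbf n$ and $i=1,\dots,k$. $\mathbb Z^k$ acts on it by ${}^{\mathbf m}v(\mathbf n)=v(\mathbf n+\mathbf m)$. A $\mathbb Z^k$-monoid isomorphism is a monoid isomorphism commuting with the $\mathbb Z^k$-actions. A vertex $v$ is an $\mathbf e_i$-sink if $\Lambda^{\mathbf e_i}v=\emptyset$. The sink deletion $k$-graph is $\Lambda_S=\{\lambda\in\Lambda: r(\lambda)\Lambda v=\emptyset\}$ with the restricted range, source, degree and composition; its vertex set is $\Lambda_S^0=\{w\in\Lambda^0: w\Lambda v=\emptyset\}$, and it is a row-finite $k$-graph without sources. *)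

theory Defs
  imports
    "HOL-Analysis.Finite_Cartesian_Product"
    "HOL-Library.Countable_Set"
    "HOL-Library.Multiset"
    "HOL-Algebra.Group"
begin

section \<open>Higher-rank graphs\<close>

text \<open>
  The rank \<open>k\<close> is the cardinality of the finite index type \<open>'k\<close>; the standard basis vector
  \<open>e\<^sub>i\<close> is \<open>axis i 1\<close>.  Objects and morphisms are kept apart, so a vertex is an object rather
  than a morphism of degree \<open>0\<close> (\<open>deg_0_iff_ident\<close> below is the identification of the two).
  The composite \<open>cmp \<Lambda> \<alpha> \<beta>\<close> is meaningful only if \<open>src \<Lambda> \<alpha> = rng \<Lambda> \<beta>\<close>.
\<close>

record ('o, 'm, 'k::finite) graph_data =
  Obj :: "'o set"
  Mor :: "'m set"
  rng :: "'m \<Rightarrow> 'o"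
  src :: "'m \<Rightarrow> 'o"
  ident :: "'o \<Rightarrow> 'm"
  cmp :: "'m \<Rightarrow> 'm \<Rightarrow> 'm"
  deg :: "'m \<Rightarrow> nat ^ 'k"

locale k_graph =
  fixes \<Lambda> :: "('o, 'm, 'k::finite) graph_data"
  assumes countable_Mor: "countable (Mor \<Lambda>)"
    and rng_Obj: "\<kappa> \<in> Mor \<Lambda> \<Longrightarrow> rng \<Lambda> \<kappa> \<in> Obj \<Lambda>"
    and src_Obj: "\<kappa> \<in> Mor \<Lambda> \<Longrightarrow> src \<Lambda> \<kappa> \<in> Obj \<Lambda>"
    and ident_Mor: "v \<in> Obj \<Lambda> \<Longrightarrow> ident \<Lambda> v \<in> Mor \<Lambda>"
    and rng_ident: "v \<in> Obj \<Lambda> \<Longrightarrow> rng \<Lambda> (ident \<Lambda> v) = v"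
    and src_ident: "v \<in> Obj \<Lambda> \<Longrightarrow> src \<Lambda> (ident \<Lambda> v) = v"
    and cmp_Mor: "\<lbrakk>\<kappa> \<in> Mor \<Lambda>; \<mu> \<in> Mor \<Lambda>; src \<Lambda> \<kappa> = rng \<Lambda> \<mu>\<rbrakk> \<Longrightarrow> cmp \<Lambda> \<kappa> \<mu> \<in> Mor \<Lambda>"
    and rng_cmp: "\<lbrakk>\<kappa> \<in> Mor \<Lambda>; \<mu> \<in> Mor \<Lambda>; src \<Lambda> \<kappa> = rng \<Lambda> \<mu>\<rbrakk>
                    \<Longrightarrow> rng \<Lambda> (cmp \<Lambda> \<kappa> \<mu>) = rng \<Lambda> \<kappa>"
    and src_cmp: "\<lbrakk>\<kappa> \<in> Mor \<Lambda>; \<mu> \<in> Mor \<Lambda>; src \<Lambda> \<kappa> = rng \<Lambda> \<mu>\<rbrakk>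
                    \<Longrightarrow> src \<Lambda> (cmp \<Lambda> \<kappa> \<mu>) = src \<Lambda> \<mu>"
    and cmp_assoc: "\<lbrakk>\<kappa> \<in> Mor \<Lambda>; \<mu> \<in> Mor \<Lambda>; \<nu> \<in> Mor \<Lambda>;
                     src \<Lambda> \<kappa> = rng \<Lambda> \<mu>; src \<Lambda> \<mu> = rng \<Lambda> \<nu>\<rbrakk>
                    \<Longrightarrow> cmp \<Lambda> (cmp \<Lambda> \<kappa> \<mu>) \<nu> = cmp \<Lambda> \<kappa> (cmp \<Lambda> \<mu> \<nu>)"
    and cmp_ident_left: "\<kappa> \<in> Mor \<Lambda> \<Longrightarrow> cmp \<Lambda> (ident \<Lambda> (rng \<Lambda> \<kappa>)) \<kappa> = \<kappa>"
    and cmp_ident_right: "\<kappa> \<in> Mor \<Lambda> \<Longrightarrow> cmp \<Lambda> \<kappa> (ident \<Lambda> (src \<Lambda> \<kappa>)) = \<kappa>"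
    and deg_ident: "v \<in> Obj \<Lambda> \<Longrightarrow> deg \<Lambda> (ident \<Lambda> v) = 0"
    and deg_cmp: "\<lbrakk>\<kappa> \<in> Mor \<Lambda>; \<mu> \<in> Mor \<Lambda>; src \<Lambda> \<kappa> = rng \<Lambda> \<mu>\<rbrakk>
                    \<Longrightarrow> deg \<Lambda> (cmp \<Lambda> \<kappa> \<mu>) = deg \<Lambda> \<kappa> + deg \<Lambda> \<mu>"
    and factorization: "\<lbrakk>\<kappa> \<in> Mor \<Lambda>; deg \<Lambda> \<kappa> = n + m\<rbrakk>
          \<Longrightarrow> \<exists>!(\<alpha>, \<beta>). \<alpha> \<in> Mor \<Lambda> \<and> \<beta> \<in> Mor \<Lambda> \<and> src \<Lambda> \<alpha> = rng \<Lambda> \<beta> \<and>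
                deg \<Lambda> \<alpha> = n \<and> deg \<Lambda> \<beta> = m \<and> \<kappa> = cmp \<Lambda> \<alpha> \<beta>"

text \<open>The sets \<open>v\<Lambda>\<^sup>n\<close>, \<open>\<Lambda>\<^sup>nv\<close> and \<open>w\<Lambda>v\<close>.\<close>

definition paths_from_range ::
    "('o, 'm, 'k::finite) graph_data \<Rightarrow> 'o \<Rightarrow> nat ^ 'k \<Rightarrow> 'm set" where
  "paths_from_range \<Lambda> v n = {\<kappa> \<in> Mor \<Lambda>. rng \<Lambda> \<kappa> = v \<and> deg \<Lambda> \<kappa> = n}"

definition paths_with_source ::
    "('o, 'm, 'k::finite) graph_data \<Rightarrow> nat ^ 'k \<Rightarrow> 'o \<Rightarrow> 'm set" where
  "paths_with_source \<Lambda> n v = {\<kappa> \<in> Mor \<Lambda>. deg \<Lambda> \<kappa> = n \<and> src \<Lambda> \<kappa> = v}"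

definition paths_between ::
    "('o, 'm, 'k::finite) graph_data \<Rightarrow> 'o \<Rightarrow> 'o \<Rightarrow> 'm set" where
  "paths_between \<Lambda> w v = {\<kappa> \<in> Mor \<Lambda>. rng \<Lambda> \<kappa> = w \<and> src \<Lambda> \<kappa> = v}"

locale row_finite_k_graph_without_sources = k_graph +
  assumes row_finite: "v \<in> Obj \<Lambda> \<Longrightarrow> finite (paths_from_range \<Lambda> v n)"
    and no_sources: "v \<in> Obj \<Lambda> \<Longrightarrow> paths_from_range \<Lambda> v n \<noteq> {}"

definition is_sink :: "('o, 'm, 'k::finite) graph_data \<Rightarrow> 'k \<Rightarrow> 'o \<Rightarrow> bool" where
  "is_sink \<Lambda> i v \<longleftrightarrow> v \<in> Obj \<Lambda> \<and> paths_with_source \<Lambda> (axis i 1) v = {}"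

definition sink_deletion ::
    "('o, 'm, 'k::finite) graph_data \<Rightarrow> 'o \<Rightarrow> ('o, 'm, 'k) graph_data" where
  "sink_deletion \<Lambda> v =
     \<Lambda>\<lparr>Obj := {w \<in> Obj \<Lambda>. paths_between \<Lambda> w v = {}},
       Mor := {\<kappa> \<in> Mor \<Lambda>. paths_between \<Lambda> (rng \<Lambda> \<kappa>) v = {}}\<rparr>"

lemma (in k_graph) deg_0_iff_ident:
  assumes "\<kappa> \<in> Mor \<Lambda>"
  shows "deg \<Lambda> \<kappa> = 0 \<longleftrightarrow> (\<exists>v\<in>Obj \<Lambda>. \<kappa> = ident \<Lambda> v)"
proof
  assume d: "deg \<Lambda> \<kappa> = 0"
  let ?P = "\<lambda>(\<alpha>, \<beta>). \<alpha> \<in> Mor \<Lambda> \<and> \<beta> \<in> Mor \<Lambda> \<and> src \<Lambda> \<alpha> = rng \<Lambda> \<beta> \<and>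
              deg \<Lambda> \<alpha> = 0 \<and> deg \<Lambda> \<beta> = 0 \<and> \<kappa> = cmp \<Lambda> \<alpha> \<beta>"
  have "\<exists>!p. ?P p"
    using factorization[OF assms, of 0 0] d by simp
  moreover have "?P (\<kappa>, ident \<Lambda> (src \<Lambda> \<kappa>))" "?P (ident \<Lambda> (rng \<Lambda> \<kappa>), \<kappa>)"
    using assms d by (simp_all add: src_Obj rng_Obj ident_Mor rng_ident src_ident deg_ident
        cmp_ident_left cmp_ident_right)
  ultimately have "(\<kappa>, ident \<Lambda> (src \<Lambda> \<kappa>)) = (ident \<Lambda> (rng \<Lambda> \<kappa>), \<kappa>)"
    by blast
  then show "\<exists>v\<in>Obj \<Lambda>. \<kappa> = ident \<Lambda> v"
    using assms rng_Obj by blast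
qed (auto simp: deg_ident)

lemma (in k_graph) paths_between_cmp_empty:
  assumes "\<kappa> \<in> Mor \<Lambda>" "paths_between \<Lambda> (rng \<Lambda> \<kappa>) v = {}"
  shows "paths_between \<Lambda> (src \<Lambda> \<kappa>) v = {}"
proof (rule ccontr)
  assume "paths_between \<Lambda> (src \<Lambda> \<kappa>) v \<noteq> {}"
  then obtain \<mu> where "\<mu> \<in> Mor \<Lambda>" "rng \<Lambda> \<mu> = src \<Lambda> \<kappa>" "src \<Lambda> \<mu> = v"
    by (auto simp: paths_between_def)
  then have "cmp \<Lambda> \<kappa> \<mu> \<in> paths_between \<Lambda> (rng \<Lambda> \<kappa>) v"
    using assms(1) by (simp add: paths_between_def cmp_Mor rng_cmp src_cmp)
  with assms(2) show False by simp
qed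

lemma (in k_graph) k_graph_sink_deletion: "k_graph (sink_deletion \<Lambda> v)"
proof
  fix \<kappa> n m
  assume "\<kappa> \<in> Mor (sink_deletion \<Lambda> v)" "deg (sink_deletion \<Lambda> v) \<kappa> = n + m"
  then have l: "\<kappa> \<in> Mor \<Lambda>" "paths_between \<Lambda> (rng \<Lambda> \<kappa>) v = {}" "deg \<Lambda> \<kappa> = n + m"
    by (auto simp: sink_deletion_def)
  let ?P = "\<lambda>\<alpha> \<beta>. \<alpha> \<in> Mor \<Lambda> \<and> \<beta> \<in> Mor \<Lambda> \<and> src \<Lambda> \<alpha> = rng \<Lambda> \<beta> \<and>
              deg \<Lambda> \<alpha> = n \<and> deg \<Lambda> \<beta> = m \<and> \<kappa> = cmp \<Lambda> \<alpha> \<beta>"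
  let ?Q = "\<lambda>\<alpha> \<beta>. \<alpha> \<in> Mor (sink_deletion \<Lambda> v) \<and> \<beta> \<in> Mor (sink_deletion \<Lambda> v) \<and>
              src (sink_deletion \<Lambda> v) \<alpha> = rng (sink_deletion \<Lambda> v) \<beta> \<and>
              deg (sink_deletion \<Lambda> v) \<alpha> = n \<and> deg (sink_deletion \<Lambda> v) \<beta> = m \<and>
              \<kappa> = cmp (sink_deletion \<Lambda> v) \<alpha> \<beta>"
  have eq: "?Q \<alpha> \<beta> \<longleftrightarrow> ?P \<alpha> \<beta>" for \<alpha> \<beta>
  proof
    assume P: "?P \<alpha> \<beta>"
    then have "paths_between \<Lambda> (rng \<Lambda> \<alpha>) v = {}"
      using l by (simp add: rng_cmp)
    moreover have "paths_between \<Lambda> (rng \<Lambda> \<beta>) v = {}"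
      using P calculation paths_between_cmp_empty[of \<alpha> v] by simp
    ultimately show "?Q \<alpha> \<beta>"
      using P by (simp add: sink_deletion_def)
  qed (simp add: sink_deletion_def)
  show "\<exists>!(\<alpha>, \<beta>). ?Q \<alpha> \<beta>"
    using factorization[OF l(1,3)] by (simp only: eq)
qed (auto simp: sink_deletion_def countable_Mor rng_Obj src_Obj ident_Mor rng_ident src_ident
      cmp_Mor rng_cmp src_cmp cmp_assoc cmp_ident_left cmp_ident_right deg_ident deg_cmp
      paths_between_cmp_empty)

lemma (in row_finite_k_graph_without_sources) row_finite_sink_deletion:
  "row_finite_k_graph_without_sources (sink_deletion \<Lambda> v)"
proof -
  interpret D: k_graph "sink_deletion \<Lambda> v" by (rule k_graph_sink_deletion)
  have "paths_from_range (sink_deletion \<Lambda> v) w n = paths_from_range \<Lambda> w n"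
    if "w \<in> Obj (sink_deletion \<Lambda> v)" for w n
    using that by (auto simp: paths_from_range_def sink_deletion_def)
  then show ?thesis
    by unfold_locales (simp_all add: row_finite no_sources sink_deletion_def)
qed


section \<open>The talented monoid\<close>

text \<open>
  The presentation is realised as the quotient of the free commutative monoid on the symbols
  \<open>v(n)\<close>, i.e. the finite multisets of pairs \<open>(v, n)\<close> with \<open>v\<close> a vertex, by the
  congruence generated by the defining relations.  The monoid is written multiplicatively.
\<close>

definition free_talented ::
    "('o, 'm, 'k::finite) graph_data \<Rightarrow> ('o \<times> (int ^ 'k)) multiset set" where
  "free_talented \<Lambda> = {M. set_mset M \<subseteq> Obj \<Lambda> \<times> UNIV}"

inductive talented_cong ::
    "('o, 'm, 'k::finite) graph_data \<Rightarrow>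
       ('o \<times> (int ^ 'k)) multiset \<Rightarrow> ('o \<times> (int ^ 'k)) multiset \<Rightarrow> bool"
  for \<Lambda> where
  relation: "v \<in> Obj \<Lambda> \<Longrightarrow>
     talented_cong \<Lambda> {#(v, n)#}
       (\<Sum>\<alpha>\<in>paths_from_range \<Lambda> v (axis i 1). {#(src \<Lambda> \<alpha>, n + axis i 1)#})"
| refl: "M \<in> free_talented \<Lambda> \<Longrightarrow> talented_cong \<Lambda> M M"
| sym: "talented_cong \<Lambda> M N \<Longrightarrow> talented_cong \<Lambda> N M"
| trans: "talented_cong \<Lambda> L M \<Longrightarrow> talented_cong \<Lambda> M N \<Longrightarrow> talented_cong \<Lambda> L N"
| add: "talented_cong \<Lambda> M N \<Longrightarrow> talented_cong \<Lambda> M' N' \<Longrightarrow> talented_cong \<Lambda> (M + M') (N + N')"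

definition talented_rel ::
    "('o, 'm, 'k::finite) graph_data \<Rightarrow> ('o \<times> (int ^ 'k)) multiset rel" where
  "talented_rel \<Lambda> = {(M, N). talented_cong \<Lambda> M N}"

definition talented_class ::
    "('o, 'm, 'k::finite) graph_data \<Rightarrow>
       ('o \<times> (int ^ 'k)) multiset \<Rightarrow> ('o \<times> (int ^ 'k)) multiset set" where
  "talented_class \<Lambda> M = talented_rel \<Lambda> `` {M}"

definition talented_monoid ::
    "('o, 'm, 'k::finite) graph_data \<Rightarrow> ('o \<times> (int ^ 'k)) multiset set monoid" where
  "talented_monoid \<Lambda> =
     \<lparr>carrier = free_talented \<Lambda> // talented_rel \<Lambda>,
      mult = (\<lambda>X Y. \<Union>M\<in>X. \<Union>N\<in>Y. talented_class \<Lambda> (M + N)),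
      one = talented_class \<Lambda> {#}\<rparr>"

definition talented_gen ::
    "('o, 'm, 'k::finite) graph_data \<Rightarrow> 'o \<Rightarrow> int ^ 'k \<Rightarrow> ('o \<times> (int ^ 'k)) multiset set" where
  "talented_gen \<Lambda> v n = talented_class \<Lambda> {#(v, n)#}"

definition shift_mset ::
    "int ^ 'k::finite \<Rightarrow> ('o \<times> (int ^ 'k)) multiset \<Rightarrow> ('o \<times> (int ^ 'k)) multiset" where
  "shift_mset m = image_mset (\<lambda>(v, n). (v, n + m))"

definition talented_action ::
    "('o, 'm, 'k::finite) graph_data \<Rightarrow> int ^ 'k \<Rightarrow>
       ('o \<times> (int ^ 'k)) multiset set \<Rightarrow> ('o \<times> (int ^ 'k)) multiset set" where
  "talented_action \<Lambda> m X = (\<Union>M\<in>X. talented_class \<Lambda> (shift_mset m M))"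

text \<open>
  \<open>iso\<close> consists of the bijective multiplicative maps, so preservation of the unit is
  required separately.
\<close>

definition equivariant_monoid_iso ::
    "('a, 'c) monoid_scheme \<Rightarrow> ('g \<Rightarrow> 'a \<Rightarrow> 'a) \<Rightarrow> ('b, 'd) monoid_scheme \<Rightarrow> ('g \<Rightarrow> 'b \<Rightarrow> 'b)
       \<Rightarrow> ('a \<Rightarrow> 'b) \<Rightarrow> bool" where
  "equivariant_monoid_iso A actA B actB \<phi> \<longleftrightarrow>
     \<phi> \<in> iso A B \<and> \<phi> \<one>\<^bsub>A\<^esub> = \<one>\<^bsub>B\<^esub> \<and>
     (\<forall>g. \<forall>x\<in>carrier A. \<phi> (actA g x) = actB g (\<phi> x))"

abbreviation Zk_monoid_iso ::
    "('o, 'm, 'k::finite) graph_data \<Rightarrow> ('p, 'n, 'k) graph_data \<Rightarrow>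
       (('o \<times> (int ^ 'k)) multiset set \<Rightarrow> ('p \<times> (int ^ 'k)) multiset set) \<Rightarrow> bool" where
  "Zk_monoid_iso \<Lambda> \<Gamma> \<equiv>
     equivariant_monoid_iso (talented_monoid \<Lambda>) (talented_action \<Lambda>)
       (talented_monoid \<Gamma>) (talented_action \<Gamma>)"

context k_graph
begin

lemma free_talented_add:
  "M \<in> free_talented \<Lambda> \<Longrightarrow> N \<in> free_talented \<Lambda> \<Longrightarrow> M + N \<in> free_talented \<Lambda>"
  by (auto simp: free_talented_def)

lemma free_talented_relation:
  "(\<Sum>\<alpha>\<in>paths_from_range \<Lambda> v d. {#(src \<Lambda> \<alpha>, n)#}) \<in> free_talented \<Lambda>"
proof (cases "finite (paths_from_range \<Lambda> v d)")
  case True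
  then show ?thesis
    by (auto simp: free_talented_def set_mset_sum paths_from_range_def src_Obj)
qed (simp add: free_talented_def)

lemma talented_cong_free:
  "talented_cong \<Lambda> M N \<Longrightarrow> M \<in> free_talented \<Lambda> \<and> N \<in> free_talented \<Lambda>"
proof (induction rule: talented_cong.induct)
  case (relation v n i)
  then show ?case using free_talented_relation by (simp add: free_talented_def)
qed (auto simp: free_talented_add)

lemma equiv_talented_rel: "equiv (free_talented \<Lambda>) (talented_rel \<Lambda>)"
proof (rule equivI)
  show "talented_rel \<Lambda> \<subseteq> free_talented \<Lambda> \<times> free_talented \<Lambda>"
    using talented_cong_free by (auto simp: talented_rel_def)
  show "refl_on (free_talented \<Lambda>) (talented_rel \<Lambda>)"
    by (simp add: refl_on_def talented_rel_def talented_cong.refl)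
  show "sym (talented_rel \<Lambda>)"
    by (simp add: sym_def talented_rel_def talented_cong.sym)
  show "trans (talented_rel \<Lambda>)"
    unfolding trans_def talented_rel_def using talented_cong.trans by blast
qed

lemma talented_class_eq_iff:
  "M \<in> free_talented \<Lambda> \<Longrightarrow> N \<in> free_talented \<Lambda> \<Longrightarrow>
     talented_class \<Lambda> M = talented_class \<Lambda> N \<longleftrightarrow> talented_cong \<Lambda> M N"
  unfolding talented_class_def
  using eq_equiv_class_iff[OF equiv_talented_rel] by (simp add: talented_rel_def)

lemma mem_talented_class_iff: "N \<in> talented_class \<Lambda> M \<longleftrightarrow> talented_cong \<Lambda> M N"
  by (simp add: talented_class_def talented_rel_def)

lemma talented_class_carrier:
  "M \<in> free_talented \<Lambda> \<Longrightarrow> talented_class \<Lambda> M \<in> carrier (talented_monoid \<Lambda>)"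
  by (simp add: talented_monoid_def talented_class_def quotientI)

lemma carrier_talentedE:
  assumes "X \<in> carrier (talented_monoid \<Lambda>)"
  obtains M where "M \<in> free_talented \<Lambda>" "X = talented_class \<Lambda> M"
  using assms by (auto simp: talented_monoid_def talented_class_def elim: quotientE)

lemma mult_talented_class:
  assumes "M \<in> free_talented \<Lambda>" "N \<in> free_talented \<Lambda>"
  shows "talented_class \<Lambda> M \<otimes>\<^bsub>talented_monoid \<Lambda>\<^esub> talented_class \<Lambda> N = talented_class \<Lambda> (M + N)"
proof -
  have "talented_class \<Lambda> (M' + N') = talented_class \<Lambda> (M + N)"
    if "M' \<in> talented_class \<Lambda> M" "N' \<in> talented_class \<Lambda> N" for M' N'
    using that by (metis mem_talented_class_iff talented_class_eq_iff talented_cong.add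
        talented_cong_free)
  then have "(\<Union>M'\<in>talented_class \<Lambda> M. \<Union>N'\<in>talented_class \<Lambda> N. talented_class \<Lambda> (M' + N')) =
      (\<Union>M'\<in>talented_class \<Lambda> M. \<Union>N'\<in>talented_class \<Lambda> N. talented_class \<Lambda> (M + N))"
    by (intro SUP_cong HOL.refl)
  moreover have "talented_class \<Lambda> M \<noteq> {}" "talented_class \<Lambda> N \<noteq> {}"
    using assms mem_talented_class_iff talented_cong.refl by blast+
  ultimately show ?thesis
    by (simp add: talented_monoid_def)
qed

lemma comm_monoid_talented: "comm_monoid (talented_monoid \<Lambda>)"
proof (rule comm_monoidI)
  have one: "\<one>\<^bsub>talented_monoid \<Lambda>\<^esub> = talented_class \<Lambda> {#}" and e: "{#} \<in> free_talented \<Lambda>"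
    by (simp_all add: talented_monoid_def free_talented_def)
  show "\<one>\<^bsub>talented_monoid \<Lambda>\<^esub> \<in> carrier (talented_monoid \<Lambda>)"
    using one e by (simp add: talented_class_carrier)
  fix X Y Z
  assume X: "X \<in> carrier (talented_monoid \<Lambda>)"
  then obtain M where M: "M \<in> free_talented \<Lambda>" "X = talented_class \<Lambda> M"
    by (rule carrier_talentedE)
  show "\<one>\<^bsub>talented_monoid \<Lambda>\<^esub> \<otimes>\<^bsub>talented_monoid \<Lambda>\<^esub> X = X"
    using one e M by (simp add: mult_talented_class)
  assume Y: "Y \<in> carrier (talented_monoid \<Lambda>)"
  then obtain N where N: "N \<in> free_talented \<Lambda>" "Y = talented_class \<Lambda> N"
    by (rule carrier_talentedE)
  show "X \<otimes>\<^bsub>talented_monoid \<Lambda>\<^esub> Y \<in> carrier (talented_monoid \<Lambda>)"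
    using M N by (simp add: mult_talented_class talented_class_carrier free_talented_add)
  show "X \<otimes>\<^bsub>talented_monoid \<Lambda>\<^esub> Y = Y \<otimes>\<^bsub>talented_monoid \<Lambda>\<^esub> X"
    using M N by (simp add: mult_talented_class add.commute)
  assume Z: "Z \<in> carrier (talented_monoid \<Lambda>)"
  then obtain L where L: "L \<in> free_talented \<Lambda>" "Z = talented_class \<Lambda> L"
    by (rule carrier_talentedE)
  show "X \<otimes>\<^bsub>talented_monoid \<Lambda>\<^esub> Y \<otimes>\<^bsub>talented_monoid \<Lambda>\<^esub> Z =
        X \<otimes>\<^bsub>talented_monoid \<Lambda>\<^esub> (Y \<otimes>\<^bsub>talented_monoid \<Lambda>\<^esub> Z)"
    using M N L by (simp add: mult_talented_class free_talented_add add.assoc)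
qed

lemma shift_mset_free: "M \<in> free_talented \<Lambda> \<Longrightarrow> shift_mset m M \<in> free_talented \<Lambda>"
  by (auto simp: free_talented_def shift_mset_def)

lemma shift_mset_sum: "shift_mset m (\<Sum>a\<in>A. f a) = (\<Sum>a\<in>A. shift_mset m (f a))"
  by (induction A rule: infinite_finite_induct) (simp_all add: shift_mset_def)

lemma talented_cong_shift:
  "talented_cong \<Lambda> M N \<Longrightarrow> talented_cong \<Lambda> (shift_mset m M) (shift_mset m N)"
proof (induction rule: talented_cong.induct)
  case (relation v n i)
  then show ?case
    using talented_cong.relation[OF relation, of "n + m" i]
    by (simp add: shift_mset_sum) (simp add: shift_mset_def ac_simps)
next
  case (add M N M' N')
  then show ?case
    using talented_cong.add[of \<Lambda> "shift_mset m M" "shift_mset m N" "shift_mset m M'" "shift_mset m N'"]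
    by (simp add: shift_mset_def)
next
  case (refl M)
  then show ?case by (simp add: shift_mset_free talented_cong.refl)
next
  case (sym M N)
  then show ?case by (simp add: talented_cong.sym)
next
  case (trans L M N)
  then show ?case using talented_cong.trans by blast
qed

lemma talented_action_class:
  assumes "M \<in> free_talented \<Lambda>"
  shows "talented_action \<Lambda> m (talented_class \<Lambda> M) = talented_class \<Lambda> (shift_mset m M)"
proof -
  have "talented_class \<Lambda> (shift_mset m M') = talented_class \<Lambda> (shift_mset m M)"
    if "M' \<in> talented_class \<Lambda> M" for M'
    using that by (metis mem_talented_class_iff talented_class_eq_iff talented_cong_shift
        talented_cong_free)
  then have "talented_action \<Lambda> m (talented_class \<Lambda> M) =
      (\<Union>M'\<in>talented_class \<Lambda> M. talented_class \<Lambda> (shift_mset m M))"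
    unfolding talented_action_def by (intro SUP_cong HOL.refl)
  moreover have "talented_class \<Lambda> M \<noteq> {}"
    using assms mem_talented_class_iff talented_cong.refl by blast
  ultimately show ?thesis
    by simp
qed

lemma talented_action_gen:
  "v \<in> Obj \<Lambda> \<Longrightarrow> talented_action \<Lambda> m (talented_gen \<Lambda> v n) = talented_gen \<Lambda> v (n + m)"
  by (simp add: talented_gen_def talented_action_class free_talented_def) (simp add: shift_mset_def)

end

end

(*
  Every deleted vertex w is itself an e_i-sink: an e_i-edge into w followed by a path from w to v
  could be refactorised with an e_i-edge ending at v.  Hence the sources of the e_i-edges with
  range w are not deleted, and replacing w(n) by the sum of s(a)(n + e_i) over these edges a
  rewrites every element of the talented monoid in terms of the surviving vertices.  This rewriting
  respects the relation of w in direction e_j because both of its sides reduce to the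
  sum of s(l)(n + e_i + e_j) over all l in w Lambda^(e_i + e_j).
*)

theory Submission imports Defs begin

section \<open>Congruences of the sink deletion inside the full graph\<close>

lemma talented_cong_sum:
  assumes "\<And>a. a \<in> A \<Longrightarrow> talented_cong \<Lambda> (f a) (g a)"
  shows "talented_cong \<Lambda> (\<Sum>a\<in>A. f a) (\<Sum>a\<in>A. g a)"
  using assms
proof (induction A rule: infinite_finite_induct)
  case (insert a A)
  then show ?case by (simp add: talented_cong.add)
\<comment> \<open>Over an infinite index set both sums are \<open>{#}\<close> by convention, so this
  case closes by reflexivity just like the empty one.\<close>
qed (auto intro: talented_cong.refl simp: free_talented_def)

text \<open>A morphism is deleted according to its range alone, so a surviving vertex keeps every
  path with that range. The defining relations at surviving vertices are thus the same in both
  graphs.\<close>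

lemma paths_from_range_sink_deletion:
  "w \<in> Obj (sink_deletion \<Lambda> v) \<Longrightarrow>
     paths_from_range (sink_deletion \<Lambda> v) w n = paths_from_range \<Lambda> w n"
  by (auto simp: paths_from_range_def sink_deletion_def)

lemma Obj_sink_deletion:
  "w \<in> Obj (sink_deletion \<Lambda> v) \<longleftrightarrow> w \<in> Obj \<Lambda> \<and> paths_between \<Lambda> w v = {}"
  by (simp add: sink_deletion_def)

lemma src_sink_deletion [simp]: "src (sink_deletion \<Lambda> v) = src \<Lambda>"
  by (simp add: sink_deletion_def)

lemma free_talented_sink_deletion:
  "M \<in> free_talented (sink_deletion \<Lambda> v) \<Longrightarrow> M \<in> free_talented \<Lambda>"
  by (auto simp: free_talented_def Obj_sink_deletion)

text \<open>Every defining relation of the sink deletion is also one of \<Lambda>. This makes the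
  inclusion of multisets well defined on classes.\<close>

lemma talented_cong_sink_deletionD:
  "talented_cong (sink_deletion \<Lambda> v) M N \<Longrightarrow> talented_cong \<Lambda> M N"
proof (induction rule: talented_cong.induct)
  case (relation w n j)
  then have "w \<in> Obj \<Lambda>"
    by (simp add: Obj_sink_deletion)
  then show ?case
    using talented_cong.relation[of w \<Lambda> n j]
    by (simp add: paths_from_range_sink_deletion[OF relation])
next
  case (refl M)
  then show ?case by (rule talented_cong.refl[OF free_talented_sink_deletion])
next
  case (sym M N)
  show ?case using sym.IH by (rule talented_cong.sym)
next
  case (trans L M N)
  then show ?case using talented_cong.trans by blast
next
  case (add M N M' N')
  then show ?case by (intro talented_cong.add)
qed

section \<open>Consequences of unique factorization\<close>

context row_finite_k_graph_without_sources
begin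

text \<open>By unique factorization, composition is a bijection from the composable pairs of degrees
  \<open>n\<close> and \<open>m\<close> onto the paths of degree \<open>n + m\<close>, and it keeps
  the source of the second factor.\<close>

lemma sum_paths_add:
  fixes h :: "'a \<Rightarrow> 'd::comm_monoid_add"
  assumes w: "w \<in> Obj \<Lambda>"
  shows "(\<Sum>\<alpha>\<in>paths_from_range \<Lambda> w n. \<Sum>\<beta>\<in>paths_from_range \<Lambda> (src \<Lambda> \<alpha>) m. h (src \<Lambda> \<beta>)) =
         (\<Sum>\<kappa>\<in>paths_from_range \<Lambda> w (n + m). h (src \<Lambda> \<kappa>))"
proof -
  let ?S = "SIGMA \<alpha>:paths_from_range \<Lambda> w n. paths_from_range \<Lambda> (src \<Lambda> \<alpha>) m"
  let ?c = "\<lambda>(\<alpha>, \<beta>). cmp \<Lambda> \<alpha> \<beta>"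
  have bij: "bij_betw ?c ?S (paths_from_range \<Lambda> w (n + m))"
  proof (rule bij_betwI')
    fix p q
    assume p: "p \<in> ?S" and q: "q \<in> ?S"
    obtain \<alpha> \<beta> \<alpha>' \<beta>' where pq: "p = (\<alpha>, \<beta>)" "q = (\<alpha>', \<beta>')"
      by fastforce
    show "?c p = ?c q \<longleftrightarrow> p = q"
    proof
      assume eq: "?c p = ?c q"
      have mor: "cmp \<Lambda> \<alpha> \<beta> \<in> Mor \<Lambda>" and deg: "deg \<Lambda> (cmp \<Lambda> \<alpha> \<beta>) = n + m"
        using p pq by (auto simp: paths_from_range_def cmp_Mor deg_cmp)
      \<comment> \<open>Both pairs factorize the same path into degrees \<open>n\<close> and
        \<open>m\<close>, so the uniqueness half of \<open>factorization\<close> identifies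
        them.\<close>
      show "p = q"
        by (rule Uniq_D[OF ex1_iff_ex_Uniq[THEN iffD1, THEN conjunct2, OF factorization[OF mor deg]]])
          (use p q pq eq in \<open>auto simp: paths_from_range_def\<close>)
    qed simp
  next
    fix p
    assume "p \<in> ?S"
    then show "?c p \<in> paths_from_range \<Lambda> w (n + m)"
      by (auto simp: paths_from_range_def cmp_Mor deg_cmp rng_cmp)
  next
    fix \<kappa>
    assume k: "\<kappa> \<in> paths_from_range \<Lambda> w (n + m)"
    then have "\<kappa> \<in> Mor \<Lambda>" "deg \<Lambda> \<kappa> = n + m"
      by (auto simp: paths_from_range_def)
    from factorization[OF this] obtain \<alpha> \<beta> where
      "\<alpha> \<in> Mor \<Lambda>" "\<beta> \<in> Mor \<Lambda>" "src \<Lambda> \<alpha> = rng \<Lambda> \<beta>" "deg \<Lambda> \<alpha> = n" "deg \<Lambda> \<beta> = m" "\<kappa> = cmp \<Lambda> \<alpha> \<beta>"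
      by blast
    with k show "\<exists>p\<in>?S. \<kappa> = ?c p"
      by (intro bexI[of _ "(\<alpha>, \<beta>)"]) (auto simp: paths_from_range_def rng_cmp)
  qed
  have "(\<Sum>\<alpha>\<in>paths_from_range \<Lambda> w n. \<Sum>\<beta>\<in>paths_from_range \<Lambda> (src \<Lambda> \<alpha>) m. h (src \<Lambda> \<beta>)) =
        (\<Sum>(\<alpha>, \<beta>)\<in>?S. h (src \<Lambda> \<beta>))"
  proof (rule sum.Sigma)
    show "\<forall>\<alpha>\<in>paths_from_range \<Lambda> w n. finite (paths_from_range \<Lambda> (src \<Lambda> \<alpha>) m)"
      by (auto intro!: row_finite src_Obj simp: paths_from_range_def[of _ w])
  qed (rule row_finite[OF w])
  also have "\<dots> = (\<Sum>p\<in>?S. h (src \<Lambda> (?c p)))"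
    by (rule sum.cong) (auto simp: paths_from_range_def src_cmp)
  also have "\<dots> = (\<Sum>\<kappa>\<in>paths_from_range \<Lambda> w (n + m). h (src \<Lambda> \<kappa>))"
    by (rule sum.reindex_bij_betw[OF bij])
  finally show ?thesis .
qed

lemma is_sink_of_path:
  assumes sink: "is_sink \<Lambda> i v" and k: "\<kappa> \<in> Mor \<Lambda>" "src \<Lambda> \<kappa> = v"
  shows "is_sink \<Lambda> i (rng \<Lambda> \<kappa>)"
proof (rule ccontr)
  assume "\<not> ?thesis"
  then obtain \<alpha> where a: "\<alpha> \<in> Mor \<Lambda>" "deg \<Lambda> \<alpha> = axis i 1" "src \<Lambda> \<alpha> = rng \<Lambda> \<kappa>"
    using k by (auto simp: is_sink_def paths_with_source_def rng_Obj)
  \<comment> \<open>The degree is written with \<open>axis i 1\<close> last, so that factorization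
    splits off the e_i-edge at the source end, where it starts from \<open>v\<close>.\<close>
  have "cmp \<Lambda> \<alpha> \<kappa> \<in> Mor \<Lambda>" "deg \<Lambda> (cmp \<Lambda> \<alpha> \<kappa>) = deg \<Lambda> \<kappa> + axis i 1"
    using a k by (simp_all add: cmp_Mor deg_cmp add.commute)
  from factorization[OF this] obtain \<mu> \<nu> where
    "\<mu> \<in> Mor \<Lambda>" "\<nu> \<in> Mor \<Lambda>" "src \<Lambda> \<mu> = rng \<Lambda> \<nu>" "deg \<Lambda> \<nu> = axis i 1" "cmp \<Lambda> \<alpha> \<kappa> = cmp \<Lambda> \<mu> \<nu>"
    by blast
  moreover from this have "src \<Lambda> \<nu> = v"
    using a k src_cmp by metis
  ultimately show False
    using sink by (auto simp: is_sink_def paths_with_source_def)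
qed

end

section \<open>Elimination of the deleted vertices\<close>

locale row_finite_k_graph_with_sink = row_finite_k_graph_without_sources \<Lambda>
  for \<Lambda> :: "('o, 'm, 'k::finite) graph_data" +
  fixes i :: 'k and v :: 'o
  assumes sink: "is_sink \<Lambda> i v"
begin

abbreviation \<Lambda>S :: "('o, 'm, 'k) graph_data" where
  "\<Lambda>S \<equiv> sink_deletion \<Lambda> v"

sublocale S: row_finite_k_graph_without_sources \<Lambda>S
  by (rule row_finite_sink_deletion)

abbreviation expansion :: "'k \<Rightarrow> 'o \<Rightarrow> int ^ 'k \<Rightarrow> ('o \<times> (int ^ 'k)) multiset" where
  "expansion j w n \<equiv> \<Sum>\<alpha>\<in>paths_from_range \<Lambda> w (axis j 1). {#(src \<Lambda> \<alpha>, n + axis j 1)#}"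

text \<open>Surviving vertices stay untouched, so that \<open>elim\<close> fixes all multisets over
  \<open>\<Lambda>S\<close>. For a deleted vertex one expansion in the sink direction
  \<open>i\<close> suffices, by \<open>src_edge_in_S\<close>.\<close>

definition elim_gen :: "'o \<times> (int ^ 'k) \<Rightarrow> ('o \<times> (int ^ 'k)) multiset" where
  "elim_gen = (\<lambda>(w, n). if w \<in> Obj \<Lambda>S then {#(w, n)#} else expansion i w n)"

definition elim :: "('o \<times> (int ^ 'k)) multiset \<Rightarrow> ('o \<times> (int ^ 'k)) multiset" where
  "elim M = (\<Sum>p\<in>#M. elim_gen p)"

lemma elim_simps [simp]:
  "elim {#} = {#}" "elim {#p#} = elim_gen p" "elim (M + N) = elim M + elim N"
  by (simp_all add: elim_def)

lemma elim_sum: "elim (\<Sum>a\<in>A. f a) = (\<Sum>a\<in>A. elim (f a))"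
  by (induction A rule: infinite_finite_induct) simp_all

lemma elim_free_S: "M \<in> free_talented \<Lambda>S \<Longrightarrow> elim M = M"
proof (induction M)
  case (add p M)
  then have "p \<in> Obj \<Lambda>S \<times> UNIV" "elim M = M"
    by (auto simp: free_talented_def)
  then show ?case
    by (cases p) (auto simp: elim_def elim_gen_def)
qed simp

text \<open>A path with this range and source \<open>v\<close> would make
  \<open>src \<Lambda> \<alpha>\<close> an e_i-sink by \<open>is_sink_of_path\<close>, but \<alpha>
  itself is an e_i-edge with that source.\<close>

lemma src_edge_in_S:
  assumes "\<alpha> \<in> Mor \<Lambda>" "deg \<Lambda> \<alpha> = axis i 1"
  shows "src \<Lambda> \<alpha> \<in> Obj \<Lambda>S"
proof (rule ccontr)
  assume "\<not> ?thesis"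
  then obtain \<kappa> where "\<kappa> \<in> Mor \<Lambda>" "rng \<Lambda> \<kappa> = src \<Lambda> \<alpha>" "src \<Lambda> \<kappa> = v"
    using assms by (auto simp: Obj_sink_deletion src_Obj paths_between_def)
  then have "is_sink \<Lambda> i (src \<Lambda> \<alpha>)"
    using is_sink_of_path[OF sink] by metis
  then show False
    using assms by (auto simp: is_sink_def paths_with_source_def)
qed

lemma expansion_free_S:
  assumes "w \<in> Obj \<Lambda>"
  shows "expansion i w n \<in> free_talented \<Lambda>S"
  using row_finite[OF assms]
  by (auto simp: free_talented_def set_mset_sum paths_from_range_def src_edge_in_S)

lemma elim_gen_free_S: "w \<in> Obj \<Lambda> \<Longrightarrow> elim_gen (w, n) \<in> free_talented \<Lambda>S"
  using expansion_free_S by (auto simp: elim_gen_def free_talented_def)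

lemma elim_free: "M \<in> free_talented \<Lambda> \<Longrightarrow> elim M \<in> free_talented \<Lambda>S"
proof (induction M)
  case (add p M)
  then show ?case
    using elim_gen_free_S[of "fst p" "snd p"] S.free_talented_add
    by (auto simp: free_talented_def elim_def)
qed (simp add: free_talented_def)

lemma talented_cong_expansion_S:
  "w \<in> Obj \<Lambda>S \<Longrightarrow> talented_cong \<Lambda>S {#(w, n)#} (expansion j w n)"
  using talented_cong.relation[of w \<Lambda>S n j] by (simp add: paths_from_range_sink_deletion)

text \<open>Modulo the congruence of \<open>\<Lambda>S\<close> the case distinction in
  \<open>elim_gen\<close> disappears: at a deleted vertex both sides coincide, at a surviving one
  this is its relation in direction \<open>i\<close>.\<close>

lemma talented_cong_elim_gen_expansion:
  assumes "w \<in> Obj \<Lambda>"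
  shows "talented_cong \<Lambda>S (elim_gen (w, n)) (expansion i w n)"
  using talented_cong_expansion_S talented_cong.refl[OF expansion_free_S[OF assms]]
  by (simp add: elim_gen_def)

text \<open>Each replacement is an instance of a defining relation of \<Lambda>. This yields
  surjectivity of \<open>sink_map\<close>.\<close>

lemma talented_cong_elim: "M \<in> free_talented \<Lambda> \<Longrightarrow> talented_cong \<Lambda> M (elim M)"
proof (induction M)
  case (add p M)
  obtain w n where p: "p = (w, n)"
    by fastforce
  with add have w: "w \<in> Obj \<Lambda>" and M: "M \<in> free_talented \<Lambda>"
    by (auto simp: free_talented_def)
  have "talented_cong \<Lambda> {#(w, n)#} (elim_gen (w, n))"
    using talented_cong.relation[OF w, of n i] talented_cong.refl[of "{#(w, n)#}" \<Lambda>] w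
    by (simp add: elim_gen_def free_talented_def)
  from talented_cong.add[OF this add.IH[OF M]] show ?case
    by (simp add: p elim_def)
qed (auto intro: talented_cong.refl simp: free_talented_def)

lemma talented_cong_elim_relation:
  assumes w: "w \<in> Obj \<Lambda>"
  shows "talented_cong \<Lambda>S (elim_gen (w, n)) (elim (expansion j w n))"
proof -
  let ?E = "\<lambda>j. paths_from_range \<Lambda> w (axis j 1)"
  let ?R = "\<lambda>d. \<Sum>\<kappa>\<in>paths_from_range \<Lambda> w d. {#(src \<Lambda> \<kappa>, n + axis i 1 + axis j 1)#}"
  note [trans] = talented_cong.trans
  have "talented_cong \<Lambda>S (elim_gen (w, n)) (expansion i w n)"
    using w by (rule talented_cong_elim_gen_expansion)
  \<comment> \<open>All sources of e_i-edges survive, so each of them has a relation in direction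
    \<open>j\<close> in \<open>\<Lambda>S\<close>.\<close>
  also have "talented_cong \<Lambda>S \<dots> (\<Sum>\<alpha>\<in>?E i. expansion j (src \<Lambda> \<alpha>) (n + axis i 1))"
    by (intro talented_cong_sum talented_cong_expansion_S src_edge_in_S)
      (auto simp: paths_from_range_def)
  also have "\<dots> = ?R (axis i 1 + axis j 1)"
    by (rule sum_paths_add[OF w])
  finally have left:
    "talented_cong \<Lambda>S (elim_gen (w, n)) (?R (axis i 1 + axis j 1))" .
  have "elim (expansion j w n) = (\<Sum>\<beta>\<in>?E j. elim_gen (src \<Lambda> \<beta>, n + axis j 1))"
    by (simp add: elim_sum)
  \<comment> \<open>The source of an e_j-edge may be deleted;
    \<open>talented_cong_elim_gen_expansion\<close> covers both cases.\<close>
  also have "talented_cong \<Lambda>S \<dots> (\<Sum>\<beta>\<in>?E j. expansion i (src \<Lambda> \<beta>) (n + axis j 1))"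
    by (intro talented_cong_sum talented_cong_elim_gen_expansion)
      (auto simp: paths_from_range_def src_Obj)
  also have "(\<Sum>\<beta>\<in>?E j. expansion i (src \<Lambda> \<beta>) (n + axis j 1)) = ?R (axis j 1 + axis i 1)"
    using sum_paths_add[OF w, where n = "axis j 1" and m = "axis i 1" and h = "\<lambda>u. {#(u, n + axis i 1 + axis j 1)#}"]
    by (simp add: add.assoc add.commute[of "axis j (1::int)"])
  \<comment> \<open>Expanding first along \<open>j\<close> and then along \<open>i\<close> reaches
    the same set of paths as the other order, because degrees commute.\<close>
  finally have right: "talented_cong \<Lambda>S (elim (expansion j w n)) (?R (axis i 1 + axis j 1))"
    by (simp add: add.commute)
  show ?thesis
    using left talented_cong.sym[OF right] by (rule talented_cong.trans)
qed

text \<open>As \<open>elim\<close> is additive, only the defining relations need an argument. Hence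
  \<open>elim\<close> descends to a map from the talented monoid of \<Lambda> to that of
  \<open>\<Lambda>S\<close>.\<close>

lemma talented_cong_elim_elim:
  "talented_cong \<Lambda> M N \<Longrightarrow> talented_cong \<Lambda>S (elim M) (elim N)"
proof (induction rule: talented_cong.induct)
  case (relation w n j)
  then show ?case unfolding elim_simps(2) by (rule talented_cong_elim_relation)
next
  case (refl M)
  then show ?case by (intro talented_cong.refl elim_free)
next
  case (sym M N)
  show ?case using sym.IH by (rule talented_cong.sym)
next
  case (trans L M N)
  then show ?case by (blast intro: talented_cong.trans)
next
  case (add M N M' N')
  then show ?case by (simp add: talented_cong.add)
qed

text \<open>Applying \<open>elim\<close> turns a congruence over \<Lambda> into one over
  \<open>\<Lambda>S\<close> and fixes both of its sides. This yields injectivity of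
  \<open>sink_map\<close>.\<close>

lemma talented_cong_S_iff:
  assumes "M \<in> free_talented \<Lambda>S" "N \<in> free_talented \<Lambda>S"
  shows "talented_cong \<Lambda>S M N \<longleftrightarrow> talented_cong \<Lambda> M N"
  using talented_cong_elim_elim[of M N] talented_cong_sink_deletionD assms
  by (auto simp: elim_free_S)

section \<open>The induced isomorphism\<close>

text \<open>This is the map induced by the inclusion of multisets. The union over all
  representatives avoids a choice; by \<open>sink_map_class\<close> they all give the same
  class.\<close>

definition sink_map :: "('o \<times> (int ^ 'k)) multiset set \<Rightarrow> ('o \<times> (int ^ 'k)) multiset set" where
  "sink_map X = (\<Union>M\<in>X. talented_class \<Lambda> M)"

lemma sink_map_class:
  assumes M: "M \<in> free_talented \<Lambda>S"
  shows "sink_map (talented_class \<Lambda>S M) = talented_class \<Lambda> M"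
proof -
  have "talented_class \<Lambda> M' = talented_class \<Lambda> M" if "M' \<in> talented_class \<Lambda>S M" for M'
    using that by (metis S.mem_talented_class_iff talented_class_eq_iff talented_cong_free
        talented_cong_sink_deletionD)
  then have "sink_map (talented_class \<Lambda>S M) = (\<Union>M'\<in>talented_class \<Lambda>S M. talented_class \<Lambda> M)"
    unfolding sink_map_def by (intro SUP_cong HOL.refl)
  moreover have "talented_class \<Lambda>S M \<noteq> {}"
    using M S.mem_talented_class_iff talented_cong.refl by blast
  ultimately show ?thesis
    by simp
qed

lemma sink_map_iso: "sink_map \<in> iso (talented_monoid \<Lambda>S) (talented_monoid \<Lambda>)"
proof -
  have "sink_map \<in> hom (talented_monoid \<Lambda>S) (talented_monoid \<Lambda>)"
  proof (rule homI)
    fix X Y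
    assume "X \<in> carrier (talented_monoid \<Lambda>S)"
    then obtain M where M: "M \<in> free_talented \<Lambda>S" "X = talented_class \<Lambda>S M"
      by (rule S.carrier_talentedE)
    then show "sink_map X \<in> carrier (talented_monoid \<Lambda>)"
      by (simp add: sink_map_class talented_class_carrier free_talented_sink_deletion)
    assume "Y \<in> carrier (talented_monoid \<Lambda>S)"
    then obtain N where N: "N \<in> free_talented \<Lambda>S" "Y = talented_class \<Lambda>S N"
      by (rule S.carrier_talentedE)
    show "sink_map (X \<otimes>\<^bsub>talented_monoid \<Lambda>S\<^esub> Y) = sink_map X \<otimes>\<^bsub>talented_monoid \<Lambda>\<^esub> sink_map Y"
      using M N by (simp add: S.mult_talented_class mult_talented_class sink_map_class
          S.free_talented_add free_talented_sink_deletion)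
  qed
  moreover have "inj_on sink_map (carrier (talented_monoid \<Lambda>S))"
  proof (rule inj_onI)
    fix X Y
    assume "X \<in> carrier (talented_monoid \<Lambda>S)"
    then obtain M where M: "M \<in> free_talented \<Lambda>S" "X = talented_class \<Lambda>S M"
      by (rule S.carrier_talentedE)
    assume "Y \<in> carrier (talented_monoid \<Lambda>S)"
    then obtain N where N: "N \<in> free_talented \<Lambda>S" "Y = talented_class \<Lambda>S N"
      by (rule S.carrier_talentedE)
    assume "sink_map X = sink_map Y"
    with M N have "talented_cong \<Lambda> M N"
      by (simp add: sink_map_class talented_class_eq_iff free_talented_sink_deletion)
    with M N show "X = Y"
      by (simp add: S.talented_class_eq_iff talented_cong_S_iff)
  qed
  moreover have "carrier (talented_monoid \<Lambda>) \<subseteq> sink_map ` carrier (talented_monoid \<Lambda>S)"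
  proof
    fix X
    assume "X \<in> carrier (talented_monoid \<Lambda>)"
    then obtain M where M: "M \<in> free_talented \<Lambda>" "X = talented_class \<Lambda> M"
      by (rule carrier_talentedE)
    \<comment> \<open>\<open>elim M\<close> is a representative of the same class over surviving
      vertices, so its class in \<open>\<Lambda>S\<close> is a preimage.\<close>
    have "X = talented_class \<Lambda> (elim M)"
      using M free_talented_sink_deletion[OF elim_free]
      by (simp add: talented_class_eq_iff talented_cong_elim)
    then have "X = sink_map (talented_class \<Lambda>S (elim M))"
      using M by (simp add: sink_map_class elim_free)
    then show "X \<in> sink_map ` carrier (talented_monoid \<Lambda>S)"
      using M by (simp add: S.talented_class_carrier elim_free)
  qed
  ultimately show ?thesis
    by (auto simp: iso_def bij_betw_def hom_def)
qed

text \<open>Shifts change only the second coordinates, so they commute with the inclusion behind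
  \<open>sink_map\<close>; the unit is the class of \<open>{#}\<close> on both sides.\<close>

lemma sink_map_Zk_monoid_iso: "Zk_monoid_iso \<Lambda>S \<Lambda> sink_map"
  unfolding equivariant_monoid_iso_def
proof (intro conjI allI ballI)
  show "sink_map \<in> iso (talented_monoid \<Lambda>S) (talented_monoid \<Lambda>)"
    by (rule sink_map_iso)
  show "sink_map \<one>\<^bsub>talented_monoid \<Lambda>S\<^esub> = \<one>\<^bsub>talented_monoid \<Lambda>\<^esub>"
    by (simp add: talented_monoid_def sink_map_class free_talented_def)
  fix m X
  assume "X \<in> carrier (talented_monoid \<Lambda>S)"
  then obtain M where M: "M \<in> free_talented \<Lambda>S" "X = talented_class \<Lambda>S M"
    by (rule S.carrier_talentedE)
  then show "sink_map (talented_action \<Lambda>S m X) = talented_action \<Lambda> m (sink_map X)"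
    by (simp add: S.talented_action_class talented_action_class sink_map_class
        S.shift_mset_free free_talented_sink_deletion)
qed

lemma sink_map_gen: "w \<in> Obj \<Lambda>S \<Longrightarrow> sink_map (talented_gen \<Lambda>S w n) = talented_gen \<Lambda> w n"
  by (simp add: talented_gen_def sink_map_class free_talented_def)

end

theorem theorem3p4:
  fixes \<Lambda> :: "('o, 'm, 'k::finite) graph_data" and i :: 'k and v :: 'o
  assumes "row_finite_k_graph_without_sources \<Lambda>"
    and "is_sink \<Lambda> i v"
  shows "\<exists>\<phi>. Zk_monoid_iso (sink_deletion \<Lambda> v) \<Lambda> \<phi> \<and>
           (\<forall>w \<in> Obj (sink_deletion \<Lambda> v). \<forall>n.
              \<phi> (talented_gen (sink_deletion \<Lambda> v) w n) = talented_gen \<Lambda> w n)"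
proof -
  interpret row_finite_k_graph_with_sink \<Lambda> i v
    using assms by (intro row_finite_k_graph_with_sink.intro row_finite_k_graph_with_sink_axioms.intro)
  show ?thesis
    using sink_map_Zk_monoid_iso sink_map_gen by blast
qed

end
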